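(* Let $G$ be a finite weighted graph with a disjoint cover $\{S_j\}_{j\in J}$ of $V(G)$ and functions $\{\psi_j\}_{j\in J}$ as in the context, and suppose that the functionals $f\mapsto\langle\zeta_j,f\rangle$, $j\in J$, are positive (i.e. $\langle\zeta_j,f\rangle\ge 0$ whenever $f(v)\ge 0$ for all $v\in V(G)$). Let $0<\gamma<1/2$. Then there exist weights $\{\varpi_j\}_{j\in J}$ with $$\frac{1-2\gamma}{1-\gamma}\,|S_j|\le \varpi_j\le \frac{3-2\gamma}{1-\gamma}\,|S_j|,\qquad j\in J,$$ such that $$\sum_{v\in V(G)}f(v)=\sum_{j\in J}\varpi_j\langle\zeta_j,f\rangle\qquad\text{for all } f\in \mathbf{E}_\omega(G),$$ where $0\le\sqrt{\omega}\le \gamma/C_\Xi$ and $C_\Xi=\sqrt{|J|\max_{j\in J}\left(|S_j|\Theta_j\right)}$.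
   Context: $G$ is an undirected weighted graph with finite vertex set $V(G)$ and symmetric weight function $w:V(G)\times V(G)\to[0,\infty)$, $w(u,u)=0$; the edges are the pairs $(u,v)$ with $w(u,v)\ne 0$. $\ell^2(G)$ is the space of all complex-valued functions on $V(G)$ with $\|f\|_{\ell^2(G)}=\left(\sum_{v}|f(v)|^2\right)^{1/2}$; write $\langle g,f\rangle=\sum_{v\in V(G)}\overline{g(v)}f(v)$. The Laplacian is $(Lf)(v)=\sum_{u\in V(G)}(f(v)-f(u))w(v,u)$. For $\omega\ge 0$, $\mathbf{E}_\omega(G)$ is the span of all eigenfunctions of $L$ with eigenvalues in $[0,\omega]$. $\{S_j\}_{j\in J}$ is a family of pairwise disjoint subsets of $V(G)$ with union $V(G)$; each $S_j$ has more than one vertex, and the induced weighted subgraph on $S_j$ (only edges with both ends in $S_j$, same weights) is connected. $L_j$ is the Laplacian of this induced subgraph, $\lambda_{1,j}>0$ is its smallest nonzero eigenvalue, and $\varphi_{0,j}=|S_j|^{-1/2}\chi_j$ its normalized eigenfunction for eigenvalue $0$, where $\chi_j$ is the characteristic function of $S_j$. For each $j$, $\psi_j\in\ell^2(G)$ is supported in $S_j$ and $\langle\psi_j,\varphi_{0,j}\rangle\neq 0$. The functional $\langle\zeta_j,\cdot\rangle$ is $$\langle\zeta_j,f\rangle=\frac{\langle\psi_j,f\rangle}{|S_j|^{1/2}\langle\psi_j,\varphi_{0,j}\rangle},$$ and $\Theta_j=\dfrac{\|\psi_j\|_{\ell^2(G)}^2}{\lambda_{1,j}\,|\langle\psi_j,\varphi_{0,j}\rangle|^2}$.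 *)

theory Defs
  imports "HOL-Analysis.Analysis" "HOL-Library.Function_Algebras" "HOL-Library.Nonpos_Ints"
begin

text \<open>
  A weighted graph is a pair of a vertex set \<open>V\<close> and a weight function \<open>w\<close>. All notions below
  read \<open>w\<close> only on \<open>V \<times> V\<close>, so the induced weighted subgraph on \<open>S \<subseteq> V\<close> is given by the pair
  of \<open>S\<close> and the same \<open>w\<close>. Functions on \<open>V\<close> are total functions vanishing outside \<open>V\<close>.
\<close>

definition weighted_graph :: "'v set \<Rightarrow> ('v \<Rightarrow> 'v \<Rightarrow> real) \<Rightarrow> bool" where
  "weighted_graph V w \<longleftrightarrow> finite V \<and>
     (\<forall>u\<in>V. \<forall>v\<in>V. 0 \<le> w u v \<and> w u v = w v u) \<and> (\<forall>u\<in>V. w u u = 0)"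

definition graph_connected :: "'v set \<Rightarrow> ('v \<Rightarrow> 'v \<Rightarrow> real) \<Rightarrow> bool" where
  "graph_connected V w \<longleftrightarrow>
     (\<forall>u\<in>V. \<forall>v\<in>V. (u, v) \<in> {(x, y). x \<in> V \<and> y \<in> V \<and> w x y \<noteq> 0}\<^sup>*)"

definition l2_space :: "'v set \<Rightarrow> ('v \<Rightarrow> complex) set" where
  "l2_space V = {f. \<forall>v. v \<notin> V \<longrightarrow> f v = 0}"

definition l2_inner :: "'v set \<Rightarrow> ('v \<Rightarrow> complex) \<Rightarrow> ('v \<Rightarrow> complex) \<Rightarrow> complex" where
  "l2_inner V g f = (\<Sum>v\<in>V. cnj (g v) * f v)"

definition l2_norm :: "'v set \<Rightarrow> ('v \<Rightarrow> complex) \<Rightarrow> real" where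
  "l2_norm V f = L2_set (\<lambda>v. cmod (f v)) V"

definition laplacian :: "'v set \<Rightarrow> ('v \<Rightarrow> 'v \<Rightarrow> real) \<Rightarrow> ('v \<Rightarrow> complex) \<Rightarrow> 'v \<Rightarrow> complex" where
  "laplacian V w f = (\<lambda>v. if v \<in> V then \<Sum>u\<in>V. (f v - f u) * of_real (w v u) else 0)"

definition eigenfunction ::
    "'v set \<Rightarrow> ('v \<Rightarrow> 'v \<Rightarrow> real) \<Rightarrow> real \<Rightarrow> ('v \<Rightarrow> complex) \<Rightarrow> bool" where
  "eigenfunction V w \<mu> f \<longleftrightarrow>
     f \<in> l2_space V \<and> f \<noteq> 0 \<and> laplacian V w f = (\<lambda>v. of_real \<mu> * f v)"

definition eigenvalues :: "'v set \<Rightarrow> ('v \<Rightarrow> 'v \<Rightarrow> real) \<Rightarrow> real set" where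
  "eigenvalues V w = {\<mu>. \<exists>f. eigenfunction V w \<mu> f}"

definition lambda1 :: "'v set \<Rightarrow> ('v \<Rightarrow> 'v \<Rightarrow> real) \<Rightarrow> real" where
  "lambda1 V w = Min (eigenvalues V w - {0})"

abbreviation (input) cscale :: "complex \<Rightarrow> ('v \<Rightarrow> complex) \<Rightarrow> 'v \<Rightarrow> complex" where
  "cscale c f \<equiv> (\<lambda>v. c * f v)"

lemma vector_space_cscale: "vector_space (cscale :: complex \<Rightarrow> ('v \<Rightarrow> complex) \<Rightarrow> _)"
  by unfold_locales (auto simp: algebra_simps fun_eq_iff)

definition E_space :: "'v set \<Rightarrow> ('v \<Rightarrow> 'v \<Rightarrow> real) \<Rightarrow> real \<Rightarrow> ('v \<Rightarrow> complex) set" where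
  "E_space V w \<omega> = module.span cscale {f. \<exists>\<mu>\<in>{0..\<omega>}. eigenfunction V w \<mu> f}"

definition phi0 :: "'v set \<Rightarrow> 'v \<Rightarrow> complex" where
  "phi0 S = (\<lambda>v. of_real (indicator S v / sqrt (real (card S))))"

text \<open>In the next two definitions \<open>S\<close> and \<open>\<psi>\<close> stand for a single $S_j$ and $\psi_j$.\<close>

definition zeta_fun :: "'v set \<Rightarrow> 'v set \<Rightarrow> ('v \<Rightarrow> complex) \<Rightarrow> ('v \<Rightarrow> complex) \<Rightarrow> complex" where
  "zeta_fun V S \<psi> f =
     l2_inner V \<psi> f / (of_real (sqrt (real (card S))) * l2_inner V \<psi> (phi0 S))"

definition Theta ::
    "'v set \<Rightarrow> ('v \<Rightarrow> 'v \<Rightarrow> real) \<Rightarrow> 'v set \<Rightarrow> ('v \<Rightarrow> complex) \<Rightarrow> real" where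
  "Theta V w S \<psi> =
     (l2_norm V \<psi>)\<^sup>2 / (lambda1 S w * (cmod (l2_inner V \<psi> (phi0 S)))\<^sup>2)"

definition C_Xi :: "'v set \<Rightarrow> ('v \<Rightarrow> 'v \<Rightarrow> real) \<Rightarrow> 'j set \<Rightarrow> ('j \<Rightarrow> 'v set) \<Rightarrow>
    ('j \<Rightarrow> 'v \<Rightarrow> complex) \<Rightarrow> real" where
  "C_Xi V w J S \<psi> =
     sqrt (real (card J) * (MAX j\<in>J. real (card (S j)) * Theta V w (S j) (\<psi> j)))"

end

theory Submission
  imports Defs
begin

text \<open>
  Positivity makes each \<open>\<zeta>\<^sub>j\<close> a weighted mean over \<open>S\<^sub>j\<close>. By the Poincare inequality on \<open>S\<^sub>j\<close> the
  \<open>\<ell>\<^sup>2\<close> error of replacing \<open>f\<close> by \<open>\<zeta>\<^sub>j f\<close> is at most \<open>\<Theta>\<^sub>j\<close> times the energy of \<open>f\<close> inside \<open>S\<^sub>j\<close>; summing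
  over \<open>j\<close> and using that a bandlimited \<open>f\<close> has energy at most \<open>\<omega> \<parallel>f\<parallel>\<^sup>2\<close>, the total \<open>\<ell>\<^sup>1\<close> error is at
  most \<open>\<gamma> \<parallel>f\<parallel>\<close>, where \<open>\<parallel>f\<parallel>\<close> may be taken in \<open>\<ell>\<^sup>1\<close>. Absorbing the error on the right bounds the functional
  \<open>f \<mapsto> \<Sum>\<^sub>v f v - \<Sum>\<^sub>j |S\<^sub>j| \<zeta>\<^sub>j f\<close> by \<open>\<gamma> / (1 - \<gamma>) \<Sum>\<^sub>j |S\<^sub>j| |\<zeta>\<^sub>j f|\<close>, and the Hahn--Banach theorem represents it
  as \<open>\<Sum>\<^sub>j \<delta>\<^sub>j \<zeta>\<^sub>j f\<close> with \<open>|\<delta>\<^sub>j| \<le> \<gamma> / (1 - \<gamma>) |S\<^sub>j|\<close>. The weights are \<open>|S\<^sub>j| + \<delta>\<^sub>j\<close>.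
\<close>

section \<open>The Dirichlet form and real eigenfunctions\<close>

definition real_laplacian :: "'v set \<Rightarrow> ('v \<Rightarrow> 'v \<Rightarrow> real) \<Rightarrow> ('v \<Rightarrow> real) \<Rightarrow> 'v \<Rightarrow> real" where
  "real_laplacian V w f v = (\<Sum>u\<in>V. (f v - f u) * w v u)"

definition real_eigenspace :: "'v set \<Rightarrow> ('v \<Rightarrow> 'v \<Rightarrow> real) \<Rightarrow> real \<Rightarrow> ('v \<Rightarrow> real) set" where
  "real_eigenspace V w \<mu> = {f. \<forall>v\<in>V. real_laplacian V w f v = \<mu> * f v}"

text \<open>The energy form of the Laplacian; the factor 1/2 compensates for meeting every edge in
  both orders.\<close>

definition dirichlet_form ::
    "'v set \<Rightarrow> ('v \<Rightarrow> 'v \<Rightarrow> real) \<Rightarrow> ('v \<Rightarrow> real) \<Rightarrow> ('v \<Rightarrow> real) \<Rightarrow> real" where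
  "dirichlet_form V w f g = (\<Sum>v\<in>V. \<Sum>u\<in>V. w v u * (f v - f u) * (g v - g u)) / 2"

lemma weighted_graph_subset:
  assumes "weighted_graph V w" "S \<subseteq> V"
  shows "weighted_graph S w"
  using assms finite_subset unfolding weighted_graph_def by blast

text \<open>Summation by parts: exchanging the names of \<open>u\<close> and \<open>v\<close> and
  using the symmetry of \<open>w\<close> gives a second expression for the left side, and the two
  add up to twice the form.\<close>

lemma dirichlet_form_laplacian:
  assumes "weighted_graph V w"
  shows "(\<Sum>v\<in>V. real_laplacian V w f v * g v) = dirichlet_form V w f g"
proof -
  have sym: "w u v = w v u" if "u \<in> V" "v \<in> V" for u v
    using assms that by (auto simp: weighted_graph_def)
  let ?A = "\<Sum>v\<in>V. \<Sum>u\<in>V. (f v - f u) * w v u * g v"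
  have "?A = (\<Sum>u\<in>V. \<Sum>v\<in>V. (f v - f u) * w v u * g v)"
    by (rule sum.swap)
  also have "\<dots> = (\<Sum>v\<in>V. \<Sum>u\<in>V. (f u - f v) * w v u * g u)"
    by (intro sum.cong refl) (simp add: sym)
  finally have "?A + ?A = (\<Sum>v\<in>V. \<Sum>u\<in>V. (f v - f u) * w v u * g v)
      + (\<Sum>v\<in>V. \<Sum>u\<in>V. (f u - f v) * w v u * g u)"
    by simp
  also have "\<dots> = (\<Sum>v\<in>V. \<Sum>u\<in>V. w v u * (f v - f u) * (g v - g u))"
    unfolding sum.distrib [symmetric] by (intro sum.cong refl) (simp add: algebra_simps)
  finally show ?thesis
    by (simp add: dirichlet_form_def real_laplacian_def flip: sum_distrib_right)
qed

lemma dirichlet_form_commute: "dirichlet_form V w f g = dirichlet_form V w g f"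
  by (simp add: dirichlet_form_def algebra_simps)

lemma dirichlet_form_self:
  "dirichlet_form V w f f = (\<Sum>v\<in>V. \<Sum>u\<in>V. w v u * (f v - f u)\<^sup>2) / 2"
  by (simp add: dirichlet_form_def power2_eq_square mult.assoc)

lemma dirichlet_form_nonneg:
  assumes "weighted_graph V w"
  shows "0 \<le> dirichlet_form V w f f"
  using assms by (auto simp: dirichlet_form_self weighted_graph_def intro!: sum_nonneg)

text \<open>Splitting into clusters only discards the edges between different clusters, and every
  edge contributes a nonnegative energy.\<close>

lemma sum_dirichlet_form_le:
  assumes "weighted_graph V w" and "finite J" and "disjoint_family_on S J" and "(\<Union>j\<in>J. S j) = V"
  shows "(\<Sum>j\<in>J. dirichlet_form (S j) w f f) \<le> dirichlet_form V w f f"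
proof -
  let ?e = "\<lambda>v u. w v u * (f v - f u)\<^sup>2"
  have fin: "finite V" and w: "\<And>u v. u \<in> V \<Longrightarrow> v \<in> V \<Longrightarrow> 0 \<le> w u v"
    using assms(1) by (auto simp: weighted_graph_def)
  have sub: "S j \<subseteq> V" if "j \<in> J" for j using assms(4) that by auto
  have "(\<Sum>j\<in>J. \<Sum>v\<in>S j. \<Sum>u\<in>S j. ?e v u) \<le> (\<Sum>j\<in>J. \<Sum>v\<in>S j. \<Sum>u\<in>V. ?e v u)"
    using sub fin w by (intro sum_mono sum_mono2) (auto intro!: mult_nonneg_nonneg dest!: subsetD)
  also have "\<dots> = (\<Sum>v\<in>V. \<Sum>u\<in>V. ?e v u)"
    using assms sub fin finite_subset
    by (subst assms(4) [symmetric], subst sum.UNION_disjoint_family) (auto intro: finite_subset)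
  finally show ?thesis
    by (simp add: dirichlet_form_self flip: sum_divide_distrib)
qed

lemma real_eigenspace_lincomb:
  assumes "f \<in> real_eigenspace V w \<mu>" and "g \<in> real_eigenspace V w \<mu>"
  shows "(\<lambda>v. a * f v + b * g v) \<in> real_eigenspace V w \<mu>"
proof -
  have "real_laplacian V w (\<lambda>v. a * f v + b * g v) v
      = a * real_laplacian V w f v + b * real_laplacian V w g v" for v
    by (simp add: real_laplacian_def sum_distrib_left sum.distrib [symmetric] algebra_simps)
  then show ?thesis
    using assms by (simp add: real_eigenspace_def algebra_simps)
qed

lemma dirichlet_form_eigen:
  assumes "weighted_graph V w" and "f \<in> real_eigenspace V w \<mu>"
  shows "dirichlet_form V w f g = \<mu> * (\<Sum>v\<in>V. f v * g v)"
  using assms by (simp add: real_eigenspace_def sum_distrib_left mult.assoc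
      flip: dirichlet_form_laplacian)

text \<open>The symmetric form can be evaluated by letting the Laplacian act on either argument,
  which yields two different multiples of one inner product.\<close>

lemma real_eigenspace_orthogonal:
  assumes "weighted_graph V w" and "f \<in> real_eigenspace V w \<mu>" and "g \<in> real_eigenspace V w \<nu>"
    and "\<mu> \<noteq> \<nu>"
  shows "(\<Sum>v\<in>V. f v * g v) = 0"
proof -
  have "\<mu> * (\<Sum>v\<in>V. f v * g v) = \<nu> * (\<Sum>v\<in>V. g v * f v)"
    using dirichlet_form_eigen [OF assms(1,2), of g] dirichlet_form_eigen [OF assms(1,3), of f]
      dirichlet_form_commute [of V w f g] by simp
  then have "(\<mu> - \<nu>) * (\<Sum>v\<in>V. f v * g v) = 0"
    by (simp add: algebra_simps)
  then show ?thesis using assms(4) by simp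
qed

section \<open>Real eigenfunctions and finiteness of the spectrum\<close>

lemma eigenfunction_Re_Im:
  assumes "eigenfunction V w \<mu> f"
  shows "(\<lambda>v. Re (f v)) \<in> real_eigenspace V w \<mu>" and "(\<lambda>v. Im (f v)) \<in> real_eigenspace V w \<mu>"
proof -
  have "(\<Sum>u\<in>V. (f v - f u) * of_real (w v u)) = of_real \<mu> * f v" if "v \<in> V" for v
    using assms that by (auto simp: eigenfunction_def laplacian_def fun_eq_iff split: if_splits)
  from this [THEN arg_cong [of _ _ Re]] this [THEN arg_cong [of _ _ Im]]
  show "(\<lambda>v. Re (f v)) \<in> real_eigenspace V w \<mu>" "(\<lambda>v. Im (f v)) \<in> real_eigenspace V w \<mu>"
    by (simp_all add: real_eigenspace_def real_laplacian_def)
qed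

text \<open>Moves the spectrum from complex to real functions: the real or the imaginary part of a
  complex eigenfunction is nonzero somewhere on \<open>V\<close>.\<close>

lemma eigenvalues_iff:
  "\<mu> \<in> eigenvalues V w \<longleftrightarrow> (\<exists>g\<in>real_eigenspace V w \<mu>. \<exists>v\<in>V. g v \<noteq> 0)"
proof
  assume "\<mu> \<in> eigenvalues V w"
  then obtain f where f: "eigenfunction V w \<mu> f"
    by (auto simp: eigenvalues_def)
  then obtain v where "v \<in> V" "f v \<noteq> 0"
    by (auto simp: eigenfunction_def l2_space_def fun_eq_iff)
  then have "(\<exists>v\<in>V. Re (f v) \<noteq> 0) \<or> (\<exists>v\<in>V. Im (f v) \<noteq> 0)"
    by (auto simp: complex_eq_iff)
  then show "\<exists>g\<in>real_eigenspace V w \<mu>. \<exists>v\<in>V. g v \<noteq> 0"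
    using eigenfunction_Re_Im [OF f, THEN bexI [of "\<lambda>g. \<exists>v\<in>V. g v \<noteq> 0", rotated]] by (elim disjE)
next
  assume "\<exists>g\<in>real_eigenspace V w \<mu>. \<exists>v\<in>V. g v \<noteq> 0"
  then obtain g x where g: "g \<in> real_eigenspace V w \<mu>" and x: "x \<in> V" "g x \<noteq> 0" by auto
  \<comment> \<open>Cutting off outside \<open>V\<close> places the function in
    \<open>l2_space V\<close>; the Laplacian at a vertex of \<open>V\<close> reads no outside
    values.\<close>
  define f :: "'a \<Rightarrow> complex" where "f = (\<lambda>v. if v \<in> V then of_real (g v) else 0)"
  have "(\<Sum>u\<in>V. (f v - f u) * of_real (w v u)) = of_real (real_laplacian V w g v)" if "v \<in> V" for v
    using that by (simp add: f_def real_laplacian_def)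
  then have "laplacian V w f = (\<lambda>v. of_real \<mu> * f v)"
    using g by (auto simp: laplacian_def fun_eq_iff real_eigenspace_def f_def)
  moreover have "f \<noteq> 0" "f \<in> l2_space V"
    using x by (auto simp: f_def fun_eq_iff l2_space_def)
  ultimately show "\<mu> \<in> eigenvalues V w"
    by (auto simp: eigenvalues_def eigenfunction_def)
qed

lemma sum_squares_pos:
  fixes g :: "'a \<Rightarrow> real"
  assumes "finite V" "v \<in> V" "g v \<noteq> 0"
  shows "0 < (\<Sum>v\<in>V. (g v)\<^sup>2)"
  using assms by (intro sum_pos2 [of V v]) auto

lemma eigenvalues_nonneg:
  assumes "weighted_graph V w" and "\<mu> \<in> eigenvalues V w"
  shows "0 \<le> \<mu>"
proof -
  obtain g v where g: "g \<in> real_eigenspace V w \<mu>" "v \<in> V" "g v \<noteq> 0"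
    using assms(2) by (auto simp: eigenvalues_iff)
  have "0 < (\<Sum>v\<in>V. (g v)\<^sup>2)"
    using g assms(1) by (intro sum_squares_pos) (auto simp: weighted_graph_def)
  moreover have "0 \<le> \<mu> * (\<Sum>v\<in>V. (g v)\<^sup>2)"
    using dirichlet_form_eigen [OF assms(1) g(1), of g] dirichlet_form_nonneg [OF assms(1), of g]
    by (simp add: power2_eq_square)
  ultimately show ?thesis by (simp add: zero_le_mult_iff)
qed

text \<open>Bessel's inequality for the point masses bounds the number of eigenvalues by \<open>card V\<close>.\<close>

lemma finite_eigenvalues:
  assumes "weighted_graph V w"
  shows "finite (eigenvalues V w)"
proof -
  have fin: "finite V" using assms by (simp add: weighted_graph_def)
  have "\<exists>g\<in>real_eigenspace V w \<mu>. (\<Sum>v\<in>V. (g v)\<^sup>2) = 1" if ev: "\<mu> \<in> eigenvalues V w" for \<mu>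
  proof -
    obtain g v where g: "g \<in> real_eigenspace V w \<mu>" "v \<in> V" "g v \<noteq> 0"
      using ev by (auto simp: eigenvalues_iff)
    define N where "N = (\<Sum>v\<in>V. (g v)\<^sup>2)"
    have N: "N > 0" unfolding N_def using sum_squares_pos [OF fin] g by blast
    have "(\<Sum>v\<in>V. (1 / sqrt N * g v + 0 * g v)\<^sup>2) = 1"
      using N by (simp add: power_mult_distrib power_divide N_def flip: sum_divide_distrib)
    then show ?thesis by (intro bexI [OF _ real_eigenspace_lincomb [OF g(1) g(1)]])
  qed
  then have "\<exists>e. \<forall>\<mu>\<in>eigenvalues V w. e \<mu> \<in> real_eigenspace V w \<mu> \<and> (\<Sum>v\<in>V. (e \<mu> v)\<^sup>2) = 1"
    by (intro bchoice) (simp add: Bex_def)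
  then obtain e where e: "e \<mu> \<in> real_eigenspace V w \<mu>" "(\<Sum>v\<in>V. (e \<mu> v)\<^sup>2) = 1"
    if "\<mu> \<in> eigenvalues V w" for \<mu>
    by blast
  \<comment> \<open>A common bound on the size of all finite subsets forces the whole spectrum to be
    finite.\<close>
  have "card M \<le> card V" if M: "finite M" "M \<subseteq> eigenvalues V w" for M
  proof -
    have orth: "(\<Sum>x\<in>V. e \<mu> x * e \<nu> x) = (if \<mu> = \<nu> then 1 else 0)" if "\<mu> \<in> M" "\<nu> \<in> M" for \<mu> \<nu>
    proof (cases "\<mu> = \<nu>")
      case True
      then show ?thesis using e(2) [of \<mu>] that M by (auto simp: power2_eq_square)
    next
      case False
      then show ?thesis
        using real_eigenspace_orthogonal [OF assms e(1) e(1) False] that M by auto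
    qed
    have bessel: "(\<Sum>\<mu>\<in>M. (e \<mu> v)\<^sup>2) \<le> 1" if v: "v \<in> V" for v
    proof -
      \<comment> \<open>\<open>p\<close> is the orthogonal projection of the point mass at
        \<open>v\<close> onto the span of the \<open>e \<mu>\<close>. Its squared norm is
        \<open>p v\<close>, so its squared distance from the point mass is
        \<open>1 - p v\<close>.\<close>
      define p where "p x = (\<Sum>\<mu>\<in>M. e \<mu> v * e \<mu> x)" for x
      have pp: "(\<Sum>x\<in>V. (p x)\<^sup>2) = p v"
      proof -
        have "(\<Sum>x\<in>V. (p x)\<^sup>2) = (\<Sum>x\<in>V. \<Sum>\<mu>\<in>M. \<Sum>\<nu>\<in>M. e \<mu> v * e \<nu> v * (e \<mu> x * e \<nu> x))"
          by (simp add: p_def power2_eq_square sum_product mult_ac)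
        also have "\<dots> = (\<Sum>\<mu>\<in>M. \<Sum>\<nu>\<in>M. \<Sum>x\<in>V. e \<mu> v * e \<nu> v * (e \<mu> x * e \<nu> x))"
          by (subst sum.swap, intro sum.cong refl, subst sum.swap) simp
        also have "\<dots> = (\<Sum>\<mu>\<in>M. \<Sum>\<nu>\<in>M. e \<mu> v * e \<nu> v * (if \<mu> = \<nu> then 1 else 0))"
          by (intro sum.cong refl) (simp add: orth flip: sum_distrib_left)
        also have "\<dots> = p v"
          using M by (simp add: p_def if_distrib sum.delta cong: if_cong)
        finally show ?thesis .
      qed
      have "0 \<le> (\<Sum>x\<in>V. ((if x = v then 1 else 0) - p x)\<^sup>2)" by (simp add: sum_nonneg)
      also have "\<dots> = (\<Sum>x\<in>V. (if x = v then 1 - 2 * p x else 0) + (p x)\<^sup>2)"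
        by (intro sum.cong refl) (auto simp: power2_eq_square algebra_simps)
      also have "\<dots> = 1 - p v"
        using fin v by (simp add: sum.distrib pp)
      finally show ?thesis by (simp add: p_def power2_eq_square)
    qed
    \<comment> \<open>Each unit vector contributes 1 to the total squared mass, which is then
      counted vertex by vertex.\<close>
    have "real (card M) = (\<Sum>\<mu>\<in>M. \<Sum>v\<in>V. (e \<mu> v)\<^sup>2)" using e(2) M by (simp add: subset_iff)
    also have "\<dots> = (\<Sum>v\<in>V. \<Sum>\<mu>\<in>M. (e \<mu> v)\<^sup>2)" by (rule sum.swap)
    also have "\<dots> \<le> (\<Sum>v\<in>V. 1)" by (intro sum_mono bessel)
    finally show ?thesis by simp
  qed
  then show ?thesis
    by (meson finite_if_finite_subsets_card_bdd)
qed

text \<open>Zero energy makes \<open>f\<close> agree across every edge, hence constant by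
  connectedness, and a constant with sum zero vanishes.\<close>

lemma dirichlet_form_pos:
  assumes "weighted_graph V w" and "graph_connected V w" and "(\<Sum>v\<in>V. f v) = 0"
    and "x \<in> V" and "f x \<noteq> 0"
  shows "0 < dirichlet_form V w f f"
proof (rule ccontr)
  assume "\<not> 0 < dirichlet_form V w f f"
  then have 0: "(\<Sum>v\<in>V. \<Sum>u\<in>V. w v u * (f v - f u)\<^sup>2) = 0"
    using dirichlet_form_nonneg [OF assms(1), of f] unfolding dirichlet_form_self by linarith
  have fin: "finite V" and w: "\<And>u v. u \<in> V \<Longrightarrow> v \<in> V \<Longrightarrow> 0 \<le> w u v"
    using assms(1) by (auto simp: weighted_graph_def)
  have edge: "f v = f u" if "v \<in> V" "u \<in> V" "w v u \<noteq> 0" for u v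
  proof -
    have "0 \<le> w x y * (f x - f y)\<^sup>2" if "x \<in> V" "y \<in> V" for x y
      using w [OF that] by (rule mult_nonneg_nonneg) simp
    then have "\<forall>x\<in>V. \<forall>y\<in>V. w x y * (f x - f y)\<^sup>2 = 0"
      using 0 by (simp add: sum_nonneg_eq_0_iff fin sum_nonneg del: mult_eq_0_iff)
    then have "w v u * (f v - f u)\<^sup>2 = 0" using that by blast
    then show ?thesis using that by simp
  qed
  have "f v = f x" if v: "v \<in> V" for v
  proof -
    have "(x, v) \<in> {(x, y). x \<in> V \<and> y \<in> V \<and> w x y \<noteq> 0}\<^sup>*"
      using assms(2,4) v by (simp add: graph_connected_def)
    then show ?thesis by induction (use edge in auto)
  qed
  then have "(\<Sum>v\<in>V. f v) = real (card V) * f x" by simp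
  then show False using assms(3-5) fin by auto
qed

section \<open>The Poincare inequality\<close>

text \<open>The energy is continuous on the compact unit sphere of mean-zero functions, so it
  attains its infimum there; quadratic homogeneity carries the bound to all mean-zero
  \<open>f\<close>.\<close>

lemma exists_rayleigh_minimizer:
  assumes "finite V" and "1 < card V"
  obtains g where "(\<Sum>v\<in>V. g v) = 0" and "(\<Sum>v\<in>V. (g v)\<^sup>2) = 1"
    and "\<And>f. (\<Sum>v\<in>V. f v) = 0 \<Longrightarrow>
           dirichlet_form V w g g * (\<Sum>v\<in>V. (f v)\<^sup>2) \<le> dirichlet_form V w f f"
proof -
  \<comment> \<open>Pinning the values outside \<open>V\<close> to 0 makes the box compact for any
    vertex type, by Tychonoff. Entries of a unit vector lie in \<open>{-1..1}\<close>, so the box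
    loses nothing of the sphere.\<close>
  define K where "K = (Pi\<^sub>E UNIV (\<lambda>v. if v \<in> V then {-1..1} else {0::real}))
      \<inter> ({f. (\<Sum>v\<in>V. f v) = 0} \<inter> {f. (\<Sum>v\<in>V. (f v)\<^sup>2) = 1})"
  have coord: "continuous_on A (\<lambda>f :: 'a \<Rightarrow> real. f v)" for A v
    by (rule continuous_on_subset [OF continuous_on_product_coordinates subset_UNIV])
  have "compact K" unfolding K_def
  proof (rule compact_Int_closed)
    have "compactin (product_topology (\<lambda>v. euclidean) UNIV)
        (Pi\<^sub>E UNIV (\<lambda>v. if v \<in> V then {-1..1} else {0::real}))"
      by (subst compactin_PiE) auto
    then show "compact (Pi\<^sub>E UNIV (\<lambda>v. if v \<in> V then {-1..1} else {0::real}))"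
      by (simp add: euclidean_product_topology flip: compactin_euclidean_iff)
    show "closed ({f. (\<Sum>v\<in>V. f v) = 0} \<inter> {f. (\<Sum>v\<in>V. (f v)\<^sup>2) = (1::real)})"
      by (intro closed_Int closed_Collect_eq continuous_intros coord)
  qed
  have normalize: "(\<lambda>v. if v \<in> V then f v / sqrt N else 0) \<in> K"
    if "(\<Sum>v\<in>V. f v) = 0" "N = (\<Sum>v\<in>V. (f v)\<^sup>2)" "N > 0" for f N
  proof -
    have "(f v)\<^sup>2 \<le> N" if "v \<in> V" for v
      using that assms(1) \<open>N = _\<close> by (auto intro: member_le_sum)
    then have "\<bar>f v\<bar> \<le> sqrt N" if "v \<in> V" for v
      using that real_le_rsqrt by fastforce
    then have abs: "\<bar>f v / sqrt N\<bar> \<le> 1" if "v \<in> V" for v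
      using that \<open>N > 0\<close> by simp
    have "-1 \<le> f v / sqrt N \<and> f v / sqrt N \<le> 1" if "v \<in> V" for v
      using abs [OF that] by linarith
    moreover have "(\<Sum>v\<in>V. f v / sqrt N) = 0" "(\<Sum>v\<in>V. (f v / sqrt N)\<^sup>2) = 1"
      using that by (simp_all add: power_divide flip: sum_divide_distrib)
    ultimately show ?thesis by (auto simp: K_def)
  qed
  have "K \<noteq> {}"
  proof -
    obtain x y where xy: "x \<in> V" "y \<in> V" "x \<noteq> y"
      using assms by (metis card_le_Suc0_iff_eq One_nat_def not_le)
    \<comment> \<open>The difference of two point masses: having two vertices is what makes the
      sphere nonempty.\<close>
    let ?f = "\<lambda>v. (if v = x then 1 else 0) - (if v = y then 1 else (0::real))"
    have "(\<Sum>v\<in>V. ?f v) = 0"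
      using assms xy by (simp add: sum_subtractf)
    moreover have "0 < (\<Sum>v\<in>V. (?f v)\<^sup>2)"
      using assms xy by (intro sum_squares_pos [of V x]) auto
    ultimately show ?thesis using normalize by blast
  qed
  moreover have "continuous_on K (\<lambda>f. dirichlet_form V w f f)"
    unfolding dirichlet_form_def by (intro continuous_intros coord) simp
  ultimately obtain g where g: "g \<in> K" "\<And>f. f \<in> K \<Longrightarrow> dirichlet_form V w g g \<le> dirichlet_form V w f f"
    using continuous_attains_inf [OF \<open>compact K\<close>] by blast
  have "dirichlet_form V w g g * (\<Sum>v\<in>V. (f v)\<^sup>2) \<le> dirichlet_form V w f f"
    if f: "(\<Sum>v\<in>V. f v) = 0" for f
  proof (cases "\<forall>v\<in>V. f v = 0")
    case True
    then show ?thesis by (simp add: dirichlet_form_def)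
  next
    case False
    then obtain x where x: "x \<in> V" "f x \<noteq> 0" by auto
    define N where "N = (\<Sum>v\<in>V. (f v)\<^sup>2)"
    have N: "N > 0" unfolding N_def using assms(1) x by (rule sum_squares_pos)
    let ?h = "\<lambda>v. if v \<in> V then f v / sqrt N else 0"
    have "dirichlet_form V w ?h ?h = dirichlet_form V w f f / N"
      using N by (simp add: dirichlet_form_self diff_divide_distrib [symmetric] power_divide
          flip: sum_divide_distrib)
    then show ?thesis
      using g(2) [OF normalize [OF f N_def N]] N by (simp add: field_simps N_def)
  qed
  moreover have "(\<Sum>v\<in>V. g v) = 0" "(\<Sum>v\<in>V. (g v)\<^sup>2) = 1"
    using g(1) by (simp_all add: K_def)
  ultimately show thesis by (intro that) assumption+
qed

text \<open>First-order condition at the minimum: moving \<open>g\<close> along its own residual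
  \<open>h\<close> changes the energy excess by a quadratic in \<open>t\<close> whose linear
  coefficient is twice the squared norm of \<open>h\<close>, which must therefore vanish.\<close>

lemma rayleigh_minimizer_eigen:
  assumes "weighted_graph V w" and "(\<Sum>v\<in>V. g v) = 0" and "(\<Sum>v\<in>V. (g v)\<^sup>2) = 1"
    and min: "\<And>f. (\<Sum>v\<in>V. f v) = 0 \<Longrightarrow> m * (\<Sum>v\<in>V. (f v)\<^sup>2) \<le> dirichlet_form V w f f"
    and m: "m = dirichlet_form V w g g"
  shows "g \<in> real_eigenspace V w m"
proof -
  have fin: "finite V" using assms(1) by (simp add: weighted_graph_def)
  define h where "h v = real_laplacian V w g v - m * g v" for v
  \<comment> \<open>Pairing the Laplacian with the constant 1 gives 0, so \<open>h\<close> has sum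
    zero and \<open>g + t h\<close> is an admissible competitor.\<close>
  have "(\<Sum>v\<in>V. real_laplacian V w g v) = 0"
    using dirichlet_form_laplacian [OF assms(1), of g "\<lambda>_. 1"] by (simp add: dirichlet_form_def)
  then have h0: "(\<Sum>v\<in>V. h v) = 0"
    using assms(2) by (simp add: h_def sum_subtractf flip: sum_distrib_left)
  define a where "a = (\<Sum>v\<in>V. (h v)\<^sup>2)"
  define b where "b = dirichlet_form V w h h - m * a"
  have cross: "dirichlet_form V w g h - m * (\<Sum>v\<in>V. g v * h v) = a"
    unfolding a_def dirichlet_form_laplacian [OF assms(1), symmetric]
    by (simp add: h_def sum_distrib_left sum_subtractf [symmetric] power2_eq_square algebra_simps)
  have quad: "0 \<le> 2 * t * a + t\<^sup>2 * b" for t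
  proof -
    have "(\<Sum>v\<in>V. g v + t * h v) = 0"
      using assms(2) h0 by (simp add: sum.distrib flip: sum_distrib_left)
    note min [OF this]
    moreover have "(\<Sum>v\<in>V. (g v + t * h v)\<^sup>2) = 1 + 2 * t * (\<Sum>v\<in>V. g v * h v) + t\<^sup>2 * a"
      unfolding assms(3) [symmetric] a_def sum_distrib_left sum.distrib [symmetric]
      by (intro sum.cong refl) (simp add: power2_eq_square algebra_simps)
    moreover have "dirichlet_form V w (\<lambda>v. g v + t * h v) (\<lambda>v. g v + t * h v)
        = m + 2 * t * dirichlet_form V w g h + t\<^sup>2 * dirichlet_form V w h h"
      unfolding m dirichlet_form_def
      by (simp add: sum_distrib_left sum.distrib [symmetric] add_divide_distrib [symmetric]
          sum_divide_distrib power2_eq_square algebra_simps)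
    ultimately show ?thesis
      using cross by (simp add: b_def algebra_simps)
  qed
  have "a = 0"
  proof (rule ccontr)
    assume "a \<noteq> 0"
    then have "a > 0" by (simp add: a_def sum_nonneg less_le)
    \<comment> \<open>Small enough that \<open>t * b \<le> a\<close>, so at \<open>- t\<close> the
      negative linear term wins; the added 1 keeps the denominator positive.\<close>
    define t where "t = a / (\<bar>b\<bar> + 1)"
    have t: "t > 0" using \<open>a > 0\<close> by (simp add: t_def)
    have "t * b \<le> t * (\<bar>b\<bar> + 1)" using t by (intro mult_left_mono) auto
    also have "\<dots> = a" by (simp add: t_def)
    finally have "t * (t * b) \<le> t * a" using t by simp
    then have "2 * (- t) * a + (- t)\<^sup>2 * b \<le> - (t * a)" by (simp add: power2_eq_square mult_ac)
    moreover have "t * a > 0" using t \<open>a > 0\<close> by simp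
    ultimately show False using quad [of "- t"] by linarith
  qed
  then have "h v = 0" if "v \<in> V" for v
    using that fin by (simp add: a_def sum_nonneg_eq_0_iff)
  then show ?thesis by (simp add: real_eigenspace_def h_def)
qed

text \<open>The minimal Rayleigh quotient on mean-zero functions is a positive eigenvalue, so the
  least nonzero eigenvalue is at most that quotient.\<close>

lemma lambda1_pos_poincare:
  assumes "weighted_graph V w" and "graph_connected V w" and "1 < card V"
  shows lambda1_pos: "0 < lambda1 V w"
    and poincare: "(\<Sum>v\<in>V. f v) = 0 \<Longrightarrow> lambda1 V w * (\<Sum>v\<in>V. (f v)\<^sup>2) \<le> dirichlet_form V w f f"
proof -
  have fin: "finite V" using assms(1) by (simp add: weighted_graph_def)
  obtain g where g: "(\<Sum>v\<in>V. g v) = 0" "(\<Sum>v\<in>V. (g v)\<^sup>2) = 1"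
    and min: "\<And>f. (\<Sum>v\<in>V. f v) = 0 \<Longrightarrow>
           dirichlet_form V w g g * (\<Sum>v\<in>V. (f v)\<^sup>2) \<le> dirichlet_form V w f f"
    using exists_rayleigh_minimizer [OF fin assms(3), of w] by metis
  define m where "m = dirichlet_form V w g g"
  have "\<exists>x\<in>V. g x \<noteq> 0"
  proof (rule ccontr)
    assume "\<not> ?thesis"
    then have "(\<Sum>v\<in>V. (g v)\<^sup>2) = 0" by simp
    then show False using g(2) by simp
  qed
  then obtain x where x: "x \<in> V" "g x \<noteq> 0" by (elim bexE)
  have "m > 0" unfolding m_def using assms(1,2) g(1) x by (rule dirichlet_form_pos)
  moreover have "g \<in> real_eigenspace V w m"
    using rayleigh_minimizer_eigen [OF assms(1) g] min by (simp add: m_def)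
  \<comment> \<open>This also shows that the set under \<open>Min\<close> is nonempty, so
    \<open>lambda1\<close> is itself an eigenvalue.\<close>
  ultimately have mem: "m \<in> eigenvalues V w - {0}"
    using x by (auto simp: eigenvalues_iff)
  have finite_ev: "finite (eigenvalues V w - {0})" using finite_eigenvalues [OF assms(1)] by simp
  have "lambda1 V w \<in> eigenvalues V w - {0}"
    unfolding lambda1_def using mem by (intro Min_in finite_ev) (rule notI, simp)
  then show "0 < lambda1 V w" using eigenvalues_nonneg [OF assms(1), of "lambda1 V w"] by simp
  have "lambda1 V w \<le> m" unfolding lambda1_def using finite_ev mem by (rule Min_le)
  then show "lambda1 V w * (\<Sum>v\<in>V. (f v)\<^sup>2) \<le> dirichlet_form V w f f" if "(\<Sum>v\<in>V. f v) = 0"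
  proof -
    have "lambda1 V w * (\<Sum>v\<in>V. (f v)\<^sup>2) \<le> m * (\<Sum>v\<in>V. (f v)\<^sup>2)"
      using \<open>lambda1 V w \<le> m\<close> by (intro mult_right_mono sum_nonneg) simp_all
    also have "\<dots> \<le> dirichlet_form V w f f" unfolding m_def by (rule min [OF that])
    finally show ?thesis .
  qed
qed

section \<open>Bandlimited functions\<close>

text \<open>Values outside \<open>V\<close> are unconstrained, unlike in \<open>E_space\<close>.\<close>

definition real_bandlimited ::
    "'v set \<Rightarrow> ('v \<Rightarrow> 'v \<Rightarrow> real) \<Rightarrow> real \<Rightarrow> ('v \<Rightarrow> real) set" where
  "real_bandlimited V w \<omega> = {f. \<exists>g. (\<forall>\<mu>. g \<mu> \<in> real_eigenspace V w \<mu>) \<and>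
     (\<forall>v\<in>V. f v = (\<Sum>\<mu>\<in>eigenvalues V w \<inter> {0..\<omega>}. g \<mu> v))}"

lemma real_bandlimited_lincomb:
  assumes "f \<in> real_bandlimited V w \<omega>" and "g \<in> real_bandlimited V w \<omega>"
  shows "(\<lambda>v. a * f v + b * g v) \<in> real_bandlimited V w \<omega>"
proof -
  obtain f' g' where f': "\<And>\<mu>. f' \<mu> \<in> real_eigenspace V w \<mu>"
      "\<And>v. v \<in> V \<Longrightarrow> f v = (\<Sum>\<mu>\<in>eigenvalues V w \<inter> {0..\<omega>}. f' \<mu> v)"
    and g': "\<And>\<mu>. g' \<mu> \<in> real_eigenspace V w \<mu>"
      "\<And>v. v \<in> V \<Longrightarrow> g v = (\<Sum>\<mu>\<in>eigenvalues V w \<inter> {0..\<omega>}. g' \<mu> v)"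
    using assms unfolding real_bandlimited_def by blast
  show ?thesis
    unfolding real_bandlimited_def mem_Collect_eq
    by (rule exI [of _ "\<lambda>\<mu> v. a * f' \<mu> v + b * g' \<mu> v"])
      (auto simp: f'(2) g'(2) sum.distrib sum_distrib_left intro: real_eigenspace_lincomb f'(1) g'(1))
qed

lemma zero_in_real_eigenspace: "(\<lambda>v. 0) \<in> real_eigenspace V w \<mu>"
  by (simp add: real_eigenspace_def real_laplacian_def)

text \<open>The decomposition has \<open>f\<close> as its only nonzero component; if
  \<open>\<mu>\<close> is not an eigenvalue, then \<open>f\<close> vanishes on \<open>V\<close> and
  the zero decomposition serves.\<close>

lemma eigen_in_real_bandlimited:
  assumes "weighted_graph V w" and "\<mu> \<in> {0..\<omega>}" and "f \<in> real_eigenspace V w \<mu>"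
  shows "f \<in> real_bandlimited V w \<omega>"
proof (cases "\<mu> \<in> eigenvalues V w")
  case True
  have "(\<Sum>\<nu>\<in>eigenvalues V w \<inter> {0..\<omega>}. (if \<nu> = \<mu> then f else (\<lambda>v. 0)) v) = f v" for v
    using True assms(2) finite_eigenvalues [OF assms(1)]
    by (simp add: if_distrib [of "\<lambda>h. h v"] cong: if_cong)
  then show ?thesis
    unfolding real_bandlimited_def mem_Collect_eq
    by (intro exI [of _ "\<lambda>\<nu>. if \<nu> = \<mu> then f else (\<lambda>v. 0)"])
      (auto simp: assms(3) zero_in_real_eigenspace)
next
  case False
  then have "\<forall>v\<in>V. f v = 0" using assms(3) by (auto simp: eigenvalues_iff)
  then show ?thesis
    unfolding real_bandlimited_def mem_Collect_eq
    by (intro exI [of _ "\<lambda>\<mu> v. 0"]) (auto simp: zero_in_real_eigenspace)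
qed

text \<open>Padding with zero components; this lets weights built for one cutoff serve all smaller
  ones.\<close>

lemma real_bandlimited_mono:
  assumes "weighted_graph V w" and "\<omega> \<le> \<omega>'"
  shows "real_bandlimited V w \<omega> \<subseteq> real_bandlimited V w \<omega>'"
proof
  fix f assume "f \<in> real_bandlimited V w \<omega>"
  then obtain g where g: "\<And>\<mu>. g \<mu> \<in> real_eigenspace V w \<mu>"
      "\<And>v. v \<in> V \<Longrightarrow> f v = (\<Sum>\<mu>\<in>eigenvalues V w \<inter> {0..\<omega>}. g \<mu> v)"
    unfolding real_bandlimited_def by blast
  have "(\<Sum>\<mu>\<in>eigenvalues V w \<inter> {0..\<omega>}. g \<mu> v)
      = (\<Sum>\<mu>\<in>eigenvalues V w \<inter> {0..\<omega>'}. (if \<mu> \<le> \<omega> then g \<mu> else (\<lambda>v. 0)) v)" for v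
    using finite_eigenvalues [OF assms(1)] assms(2)
    by (intro sum.mono_neutral_cong_left) auto
  then show "f \<in> real_bandlimited V w \<omega>'"
    unfolding real_bandlimited_def mem_Collect_eq
    by (intro exI [of _ "\<lambda>\<mu>. if \<mu> \<le> \<omega> then g \<mu> else (\<lambda>v. 0)"])
      (auto simp: g zero_in_real_eigenspace)
qed

text \<open>The functions with both parts bandlimited form a complex subspace, since a complex
  scalar only mixes the two parts by real coefficients. It contains the generating eigenfunctions,
  hence their span.\<close>

lemma E_space_Re_Im:
  assumes "weighted_graph V w" and "f \<in> E_space V w \<omega>"
  shows "(\<lambda>v. Re (f v)) \<in> real_bandlimited V w \<omega> \<and> (\<lambda>v. Im (f v)) \<in> real_bandlimited V w \<omega>"
proof -
  interpret cv: vector_space "cscale :: complex \<Rightarrow> ('a \<Rightarrow> complex) \<Rightarrow> _"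
    by (rule vector_space_cscale)
  have zero: "(\<lambda>v. 0) \<in> real_bandlimited V w \<omega>"
    unfolding real_bandlimited_def mem_Collect_eq
    by (intro exI [of _ "\<lambda>\<mu> v. 0"]) (auto simp: zero_in_real_eigenspace)
  have "cv.subspace {f. (\<lambda>v. Re (f v)) \<in> real_bandlimited V w \<omega> \<and> (\<lambda>v. Im (f v)) \<in> real_bandlimited V w \<omega>}"
    (is "cv.subspace ?W")
  proof (rule cv.subspaceI)
    show "0 \<in> ?W" using zero by simp
    show "f + g \<in> ?W" if "f \<in> ?W" "g \<in> ?W" for f g
      using that real_bandlimited_lincomb [of "\<lambda>v. Re (f v)" V w \<omega> "\<lambda>v. Re (g v)" 1 1]
        real_bandlimited_lincomb [of "\<lambda>v. Im (f v)" V w \<omega> "\<lambda>v. Im (g v)" 1 1] by simp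
    show "cscale c f \<in> ?W" if "f \<in> ?W" for c f
      using that real_bandlimited_lincomb [of "\<lambda>v. Re (f v)" V w \<omega> "\<lambda>v. Im (f v)" "Re c" "- Im c"]
        real_bandlimited_lincomb [of "\<lambda>v. Im (f v)" V w \<omega> "\<lambda>v. Re (f v)" "Re c" "Im c"] by simp
  qed
  moreover have "{f. \<exists>\<mu>\<in>{0..\<omega>}. eigenfunction V w \<mu> f} \<subseteq> ?W"
    using eigen_in_real_bandlimited [OF assms(1)] eigenfunction_Re_Im by blast
  ultimately have "cv.span {f. \<exists>\<mu>\<in>{0..\<omega>}. eigenfunction V w \<mu> f} \<subseteq> ?W"
    by (rule cv.span_minimal [rotated])
  then show ?thesis using assms(2) by (auto simp: E_space_def)
qed

text \<open>By orthogonality of the components, both energy and squared norm split over the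
  eigenvalues, and each component's energy is \<open>\<mu> \<le> \<omega>\<close> times its squared
  norm \<open>n \<mu>\<close>.\<close>

lemma dirichlet_form_bandlimited:
  assumes "weighted_graph V w" and "f \<in> real_bandlimited V w \<omega>"
  shows "dirichlet_form V w f f \<le> \<omega> * (\<Sum>v\<in>V. (f v)\<^sup>2)"
proof -
  define M where "M = eigenvalues V w \<inter> {0..\<omega>}"
  obtain g where g: "\<And>\<mu>. g \<mu> \<in> real_eigenspace V w \<mu>"
      "\<And>v. v \<in> V \<Longrightarrow> f v = (\<Sum>\<mu>\<in>M. g \<mu> v)"
    using assms(2) unfolding real_bandlimited_def M_def by blast
  have M: "finite M" using finite_eigenvalues [OF assms(1)] by (simp add: M_def)
  define n where "n \<mu> = (\<Sum>v\<in>V. (g \<mu> v)\<^sup>2)" for \<mu>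
  have inner: "(\<Sum>v\<in>V. g \<mu> v * f v) = n \<mu>" if "\<mu> \<in> M" for \<mu>
  proof -
    have "(\<Sum>v\<in>V. g \<mu> v * f v) = (\<Sum>v\<in>V. \<Sum>\<nu>\<in>M. g \<mu> v * g \<nu> v)"
      by (simp add: g(2) sum_distrib_left)
    also have "\<dots> = (\<Sum>\<nu>\<in>M. \<Sum>v\<in>V. g \<mu> v * g \<nu> v)" by (rule sum.swap)
    also have "\<dots> = (\<Sum>\<nu>\<in>M. if \<nu> = \<mu> then n \<mu> else 0)"
      using real_eigenspace_orthogonal [OF assms(1) g(1) g(1)]
      by (intro sum.cong refl) (auto simp: n_def power2_eq_square)
    finally show ?thesis using M that by simp
  qed
  have norm: "(\<Sum>v\<in>V. (f v)\<^sup>2) = (\<Sum>\<mu>\<in>M. n \<mu>)"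
  proof -
    have "(\<Sum>v\<in>V. (f v)\<^sup>2) = (\<Sum>v\<in>V. \<Sum>\<mu>\<in>M. g \<mu> v * f v)"
      by (simp add: power2_eq_square g(2) sum_distrib_right)
    also have "\<dots> = (\<Sum>\<mu>\<in>M. \<Sum>v\<in>V. g \<mu> v * f v)" by (rule sum.swap)
    finally show ?thesis by (simp add: inner)
  qed
  have "dirichlet_form V w f f = (\<Sum>v\<in>V. \<Sum>\<mu>\<in>M. real_laplacian V w f v * g \<mu> v)"
    by (simp add: g(2) sum_distrib_left flip: dirichlet_form_laplacian [OF assms(1)])
  also have "\<dots> = (\<Sum>\<mu>\<in>M. \<Sum>v\<in>V. real_laplacian V w f v * g \<mu> v)" by (rule sum.swap)
  also have "\<dots> = (\<Sum>\<mu>\<in>M. \<mu> * n \<mu>)"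
    by (simp add: dirichlet_form_laplacian [OF assms(1)] dirichlet_form_commute [of V w f]
        dirichlet_form_eigen [OF assms(1) g(1)] inner)
  also have "\<dots> \<le> (\<Sum>\<mu>\<in>M. \<omega> * n \<mu>)"
    by (intro sum_mono mult_right_mono) (auto simp: M_def n_def sum_nonneg)
  finally show ?thesis by (simp add: norm sum_distrib_left)
qed

section \<open>Sampling and quadrature\<close>

text \<open>Writing \<open>G\<close> for the squared deviation from the plain mean and
  \<open>y\<close> for the gap between the two means, the error is \<open>G + n * y\<^sup>2\<close>;
  Cauchy-Schwarz controls \<open>y\<close>.\<close>

lemma weighted_mean_error:
  fixes a f :: "'v \<Rightarrow> real"
  assumes "finite S" and "S \<noteq> {}" and a: "(\<Sum>v\<in>S. a v) = 1"
  shows "(\<Sum>v\<in>S. (f v - (\<Sum>u\<in>S. a u * f u))\<^sup>2)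
    \<le> real (card S) * (\<Sum>v\<in>S. (a v)\<^sup>2) * (\<Sum>v\<in>S. (f v - (\<Sum>u\<in>S. f u) / real (card S))\<^sup>2)"
proof -
  define n where "n = real (card S)"
  define m where "m = (\<Sum>u\<in>S. f u) / n"
  define g where "g v = f v - m" for v
  define y where "y = (\<Sum>v\<in>S. a v * g v)"
  define G where "G = (\<Sum>v\<in>S. (g v)\<^sup>2)"
  have n: "n > 0" using assms by (simp add: n_def card_gt_0_iff)
  have g0: "(\<Sum>v\<in>S. g v) = 0"
    using n by (simp add: g_def m_def sum_subtractf flip: n_def)
  have "y = (\<Sum>u\<in>S. a u * f u) - (\<Sum>u\<in>S. a u) * m"
    unfolding y_def sum_distrib_right sum_subtractf [symmetric] by (simp add: g_def algebra_simps)
  then have af: "(\<Sum>u\<in>S. a u * f u) = y + m" by (simp add: a)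
  have "(\<Sum>v\<in>S. (f v - (y + m))\<^sup>2) = (\<Sum>v\<in>S. (g v)\<^sup>2 - 2 * y * g v + y\<^sup>2)"
    by (intro sum.cong refl) (simp add: g_def power2_eq_square algebra_simps)
  also have "\<dots> = G + n * y\<^sup>2"
    using g0 by (simp add: sum.distrib sum_subtractf G_def n_def flip: sum_distrib_left)
  finally have err: "(\<Sum>v\<in>S. (f v - (y + m))\<^sup>2) = G + n * y\<^sup>2" .
  have "(\<Sum>v\<in>S. (a v - 1 / n) * g v) = y - 1 / n * (\<Sum>v\<in>S. g v)"
    unfolding y_def sum_distrib_left sum_subtractf [symmetric] by (simp add: algebra_simps)
  \<comment> \<open>Since \<open>g\<close> sums to zero, the uniform weight may be subtracted before
    Cauchy-Schwarz. This lowers the squared norm of \<open>a\<close> by \<open>1 / n\<close>, which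
    later cancels the summand \<open>G\<close>.\<close>
  then have "y = (\<Sum>v\<in>S. (a v - 1 / n) * g v)" by (simp add: g0)
  then have "y\<^sup>2 \<le> (\<Sum>v\<in>S. (a v - 1 / n)\<^sup>2) * G"
    unfolding G_def by (simp only: Cauchy_Schwarz_ineq_sum)
  also have "(\<Sum>v\<in>S. (a v - 1 / n)\<^sup>2) = (\<Sum>v\<in>S. (a v)\<^sup>2 - 2 / n * a v + (1 / n)\<^sup>2)"
    by (intro sum.cong refl) (simp add: power2_eq_square algebra_simps)
  also have "\<dots> = (\<Sum>v\<in>S. (a v)\<^sup>2) - 2 / n * (\<Sum>v\<in>S. a v) + n * (1 / n)\<^sup>2"
    unfolding sum.distrib sum_subtractf sum_distrib_left [symmetric] by (simp add: n_def)
  also have "\<dots> = (\<Sum>v\<in>S. (a v)\<^sup>2) - 1 / n"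
    using n by (simp add: a power2_eq_square)
  finally have "n * y\<^sup>2 \<le> n * (((\<Sum>v\<in>S. (a v)\<^sup>2) - 1 / n) * G)"
    using n by (intro mult_left_mono) auto
  also have "\<dots> = n * (\<Sum>v\<in>S. (a v)\<^sup>2) * G - G"
    using n by (simp add: algebra_simps)
  finally have "G + n * y\<^sup>2 \<le> n * (\<Sum>v\<in>S. (a v)\<^sup>2) * G" by simp
  then show ?thesis
    unfolding af err by (simp add: G_def g_def m_def n_def)
qed

text \<open>A finite-dimensional Hahn--Banach theorem for a weighted \<open>\<ell>\<^sup>1\<close> norm, by extending over one
  coordinate at a time: the admissible values of the new coefficient form pairwise intersecting
  intervals.\<close>

lemma dominated_functional_representation:
  fixes E :: "('v \<Rightarrow> real) set" and z :: "'j \<Rightarrow> ('v \<Rightarrow> real) \<Rightarrow> real"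
  assumes "finite J"
    and E: "\<And>f g a b. f \<in> E \<Longrightarrow> g \<in> E \<Longrightarrow> (\<lambda>v. a * f v + b * g v) \<in> E"
    and z: "\<And>j f g a b. j \<in> J \<Longrightarrow> z j (\<lambda>v. a * f v + b * g v) = a * z j f + b * z j g"
    and R: "\<And>f g a b. R (\<lambda>v. a * f v + b * g v) = a * R f + b * R g"
    and c: "\<And>j. j \<in> J \<Longrightarrow> 0 \<le> c j"
    and bound: "\<And>f. f \<in> E \<Longrightarrow> \<bar>R f\<bar> \<le> (\<Sum>j\<in>J. c j * \<bar>z j f\<bar>)"
  shows "\<exists>\<delta>. (\<forall>j\<in>J. \<bar>\<delta> j\<bar> \<le> c j) \<and> (\<forall>f\<in>E. R f = (\<Sum>j\<in>J. \<delta> j * z j f))"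
  using assms(1) z R c bound
proof (induction J arbitrary: R rule: finite_induct)
  case empty
  then show ?case by force
next
  case (insert k J)
  note zlin = insert.prems(1) and Rlin = insert.prems(2)
  define P where "P f = (\<Sum>j\<in>J. c j * \<bar>z j f\<bar>)" for f
  have Pnn: "0 \<le> P f" for f
    unfolding P_def using insert.prems(3) by (intro sum_nonneg mult_nonneg_nonneg) auto
  \<comment> \<open>The triangle inequality, with the difference written as a linear combination to
    match the linearity assumptions.\<close>
  have Pdiff: "P (\<lambda>v. 1 * f v + (- 1) * g v) \<le> P f + P g" for f g
    unfolding P_def sum.distrib [symmetric]
  proof (intro sum_mono)
    fix j assume j: "j \<in> J"
    have "c j * \<bar>z j (\<lambda>v. 1 * f v + (- 1) * g v)\<bar> \<le> c j * (\<bar>z j f\<bar> + \<bar>z j g\<bar>)"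
    proof (rule mult_left_mono)
      have "z j (\<lambda>v. 1 * f v + (- 1) * g v) = z j f - z j g"
        using zlin [of j 1 f "- 1" g] j by simp
      then show "\<bar>z j (\<lambda>v. 1 * f v + (- 1) * g v)\<bar> \<le> \<bar>z j f\<bar> + \<bar>z j g\<bar>" by linarith
      show "0 \<le> c j" using insert.prems(3) j by simp
    qed
    then show "c j * \<bar>z j (\<lambda>v. 1 * f v + (- 1) * g v)\<bar> \<le> c j * \<bar>z j f\<bar> + c j * \<bar>z j g\<bar>"
      by (simp add: distrib_left)
  qed
  have dom: "\<bar>R f\<bar> \<le> c k * \<bar>z k f\<bar> + P f" if "f \<in> E" for f
    using insert.prems(4) [OF that] insert.hyps by (simp add: P_def)
  have ck: "0 \<le> c k" using insert.prems(3) by simp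
  obtain d where d: "\<bar>d\<bar> \<le> c k" "\<And>f. f \<in> E \<Longrightarrow> \<bar>R f - d * z k f\<bar> \<le> P f"
  proof -
    define E1 where "E1 = {f \<in> E. z k f = 1}"
    \<comment> \<open>The largest lower bound imposed on the new coefficient. Inserting
      \<open>- c k\<close> keeps the set nonempty when \<open>z k\<close> vanishes on
      \<open>E\<close>, and forces \<open>- c k \<le> d\<close>.\<close>
    define d where "d = Sup (insert (- c k) ((\<lambda>f. R f - P f) ` E1))"
    \<comment> \<open>\<open>f - g\<close> is annihilated by \<open>z k\<close>, so there the bound
      on \<open>R\<close> involves only \<open>P\<close>: every lower end lies below every upper
      end.\<close>
    have upper: "R f - P f \<le> R g + P g" if "f \<in> E1" "g \<in> E1" for f g
    proof -
      let ?h = "\<lambda>v. 1 * f v + (- 1) * g v"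
      have fg: "f \<in> E" "g \<in> E" "z k f = 1" "z k g = 1" using that by (auto simp: E1_def)
      have "z k ?h = 0" using zlin [of k 1 f "- 1" g] fg by simp
      then have "\<bar>R ?h\<bar> \<le> P ?h" using dom [OF E [OF fg(1,2), of 1 "- 1"]] by simp
      moreover have "R ?h = R f - R g" using Rlin [of 1 f "- 1" g] by simp
      ultimately show ?thesis using Pdiff [of f g] by linarith
    qed
    have bnd: "- c k \<le> R f + P f" "R f - P f \<le> c k" if "f \<in> E1" for f
    proof -
      have "\<bar>R f\<bar> \<le> c k + P f" using dom [of f] that by (simp add: E1_def)
      then show "- c k \<le> R f + P f" "R f - P f \<le> c k" by linarith+
    qed
    have le_ck: "x \<le> c k" if "x \<in> insert (- c k) ((\<lambda>f. R f - P f) ` E1)" for x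
      using that ck bnd(2) by fastforce
    have bdd: "bdd_above (insert (- c k) ((\<lambda>f. R f - P f) ` E1))"
      using le_ck by (rule bdd_aboveI)
    have "d \<le> c k"
      unfolding d_def by (intro cSup_least le_ck) simp
    moreover have "- c k \<le> d"
      unfolding d_def using bdd by (intro cSup_upper) auto
    ultimately have 1: "\<bar>d\<bar> \<le> c k" by simp
    have d_lower: "R f - P f \<le> d" if "f \<in> E1" for f
      unfolding d_def using bdd that by (intro cSup_upper) auto
    have d_upper: "d \<le> R g + P g" if g: "g \<in> E1" for g
      unfolding d_def
    proof (intro cSup_least)
      fix x assume "x \<in> insert (- c k) ((\<lambda>f. R f - P f) ` E1)"
      then show "x \<le> R g + P g" using bnd(1) [OF g] upper [OF _ g] by auto
    qed simp
    have "\<bar>R f - d * z k f\<bar> \<le> P f" if f: "f \<in> E" for f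
    proof (cases "z k f = 0")
      case True
      then show ?thesis using dom [OF f] by simp
    next
      case False
      define t where "t = z k f"
      \<comment> \<open>Rescaling to \<open>z k\<close> equal to 1 reduces to \<open>E1\<close>;
        multiplying back by \<open>\<bar>t\<bar>\<close> undoes it.\<close>
      let ?h = "\<lambda>v. (1 / t) * f v + 0 * f v"
      have t: "t \<noteq> 0" using False by (simp add: t_def)
      have "?h \<in> E1"
        using E [OF f f, of "1 / t" 0] zlin [of k "1 / t" f 0 f] t by (simp add: E1_def t_def)
      then have "\<bar>R ?h - d\<bar> \<le> P ?h" using d_lower [of ?h] d_upper [of ?h] by linarith
      moreover have "R ?h = R f / t" using Rlin [of "1 / t" f 0 f] by simp
      moreover have "P ?h = P f / \<bar>t\<bar>"
        unfolding P_def sum_divide_distrib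
      proof (intro sum.cong refl)
        fix j assume "j \<in> J"
        then show "c j * \<bar>z j ?h\<bar> = c j * \<bar>z j f\<bar> / \<bar>t\<bar>"
          using zlin [of j "1 / t" f 0 f] by simp
      qed
      ultimately have "\<bar>R f / t - d\<bar> * \<bar>t\<bar> \<le> P f" using t by (simp add: pos_le_divide_eq)
      also have "\<bar>R f / t - d\<bar> * \<bar>t\<bar> = \<bar>R f - d * t\<bar>"
        using t by (simp add: left_diff_distrib flip: abs_mult)
      finally show ?thesis by (simp add: t_def)
    qed
    with 1 show thesis by (rule that)
  qed
  \<comment> \<open>The choice of \<open>d\<close> makes \<open>R - d * z k\<close> dominated by the
    remaining coordinates, so the induction hypothesis applies to this new functional.\<close>
  have "\<exists>\<delta>. (\<forall>j\<in>J. \<bar>\<delta> j\<bar> \<le> c j) \<and> (\<forall>f\<in>E. R f - d * z k f = (\<Sum>j\<in>J. \<delta> j * z j f))"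
  proof (rule insert.IH)
    show "z j (\<lambda>v. a * f v + b * g v) = a * z j f + b * z j g" if "j \<in> J" for j f g a b
      using that zlin by simp
    show "R (\<lambda>v. a * f v + b * g v) - d * z k (\<lambda>v. a * f v + b * g v)
        = a * (R f - d * z k f) + b * (R g - d * z k g)" for f g a b
      by (simp only: Rlin zlin insertI1) (simp add: algebra_simps)
    show "0 \<le> c j" if "j \<in> J" for j using that insert.prems(3) by simp
    show "\<bar>R f - d * z k f\<bar> \<le> (\<Sum>j\<in>J. c j * \<bar>z j f\<bar>)" if "f \<in> E" for f
      using d(2) [OF that] by (simp only: P_def)
  qed
  then obtain \<delta> where \<delta>: "\<forall>j\<in>J. \<bar>\<delta> j\<bar> \<le> c j"
      "\<forall>f\<in>E. R f - d * z k f = (\<Sum>j\<in>J. \<delta> j * z j f)"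
    by auto
  have "(\<Sum>j\<in>J. (\<delta>(k := d)) j * z j f) = (\<Sum>j\<in>J. \<delta> j * z j f)" for f
    using insert.hyps by (intro sum.cong) auto
  then have "(\<Sum>j\<in>insert k J. (\<delta>(k := d)) j * z j f) = d * z k f + (\<Sum>j\<in>J. \<delta> j * z j f)" for f
    using insert.hyps by (simp del: fun_upd_apply) simp
  moreover have "\<forall>j\<in>insert k J. \<bar>(\<delta>(k := d)) j\<bar> \<le> c j"
    using \<delta>(1) d(1) by simp
  ultimately show ?case
    using \<delta>(2) by (intro exI [of _ "\<delta>(k := d)"]) (simp add: algebra_simps)
qed

text \<open>Cauchy-Schwarz is used twice to pass from squared to absolute errors: within a cluster
  it costs the second factor \<open>card (S j)\<close> in the bound involving \<open>B\<close>,
  across clusters it costs \<open>card J\<close>.\<close>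

lemma sampling_error_dominated:
  fixes a :: "'j \<Rightarrow> 'v \<Rightarrow> real"
  assumes graph: "weighted_graph V w" and "finite J"
    and disjoint: "disjoint_family_on S J" and cover: "(\<Union>j\<in>J. S j) = V"
    and large: "\<And>j. j \<in> J \<Longrightarrow> card (S j) > 1"
    and connected: "\<And>j. j \<in> J \<Longrightarrow> graph_connected (S j) w"
    and a: "\<And>j. j \<in> J \<Longrightarrow> (\<Sum>v\<in>S j. a j v) = 1"
    and B: "\<And>j. j \<in> J \<Longrightarrow>
        real (card (S j)) * (real (card (S j)) * (\<Sum>v\<in>S j. (a j v)\<^sup>2)) \<le> B * lambda1 (S j) w"
    and small: "real (card J) * B * \<omega> \<le> \<gamma>\<^sup>2" "0 \<le> \<gamma>" "\<gamma> < 1"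
    and f: "f \<in> real_bandlimited V w \<omega>"
  shows "\<bar>(\<Sum>v\<in>V. f v) - (\<Sum>j\<in>J. real (card (S j)) * (\<Sum>v\<in>S j. a j v * f v))\<bar>
    \<le> (\<Sum>j\<in>J. \<gamma> / (1 - \<gamma>) * real (card (S j)) * \<bar>\<Sum>v\<in>S j. a j v * f v\<bar>)"
proof -
  define z where "z j = (\<Sum>v\<in>S j. a j v * f v)" for j
  define e where "e j = (\<Sum>v\<in>S j. \<bar>f v - z j\<bar>)" for j
  have fin: "finite V" using graph by (simp add: weighted_graph_def)
  have sub: "S j \<subseteq> V" if "j \<in> J" for j using cover that by auto
  have finS: "finite (S j)" if "j \<in> J" for j using sub [OF that] fin finite_subset by blast
  have split: "(\<Sum>v\<in>V. h v) = (\<Sum>j\<in>J. \<Sum>v\<in>S j. h v)" for h :: "'v \<Rightarrow> real"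
    unfolding cover [symmetric] using finS assms(2) disjoint
    by (intro sum.UNION_disjoint_family) auto
  have B_nonneg: "0 \<le> B" if j: "j \<in> J" for j
  proof -
    have "0 \<le> B * lambda1 (S j) w"
      using B [OF j] by (rule order_trans [rotated]) (simp add: sum_nonneg)
    moreover have "0 < lambda1 (S j) w"
      using lambda1_pos [OF weighted_graph_subset [OF graph sub] connected large] j by blast
    ultimately show ?thesis by (simp add: zero_le_mult_iff)
  qed
  have cluster: "(e j)\<^sup>2 \<le> B * dirichlet_form (S j) w f f" if j: "j \<in> J" for j
  proof -
    let ?n = "real (card (S j))"
    define m where "m = (\<Sum>v\<in>S j. f v) / ?n"
    define G where "G = (\<Sum>v\<in>S j. (f v - m)\<^sup>2)"
    have n: "?n > 0" using large [OF j] by simp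
    have wg: "weighted_graph (S j) w" by (rule weighted_graph_subset [OF graph sub [OF j]])
    have "(e j)\<^sup>2 \<le> (\<Sum>v\<in>S j. (f v - z j)\<^sup>2) * ?n"
      using Cauchy_Schwarz_ineq_sum [of "\<lambda>v. \<bar>f v - z j\<bar>" "\<lambda>_. 1" "S j"] by (simp add: e_def)
    also have "\<dots> \<le> ?n * (\<Sum>v\<in>S j. (a j v)\<^sup>2) * G * ?n"
    proof (rule mult_right_mono)
      have "S j \<noteq> {}" using n by auto
      then show "(\<Sum>v\<in>S j. (f v - z j)\<^sup>2) \<le> ?n * (\<Sum>v\<in>S j. (a j v)\<^sup>2) * G"
        unfolding z_def G_def m_def by (rule weighted_mean_error [OF finS [OF j] _ a [OF j]])
    qed simp
    also have "\<dots> = ?n * (?n * (\<Sum>v\<in>S j. (a j v)\<^sup>2)) * G" by simp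
    also have "\<dots> \<le> B * lambda1 (S j) w * G"
      using B [OF j] by (intro mult_right_mono) (auto simp: G_def sum_nonneg)
    also have "\<dots> \<le> B * dirichlet_form (S j) w f f"
    proof -
      have "(\<Sum>v\<in>S j. f v - m) = 0" using n by (simp add: m_def sum_subtractf)
      then have "lambda1 (S j) w * G \<le> dirichlet_form (S j) w (\<lambda>v. f v - m) (\<lambda>v. f v - m)"
        unfolding G_def by (rule poincare [OF wg connected [OF j] large [OF j]])
      \<comment> \<open>The energy depends only on differences, so subtracting the mean leaves it
        unchanged.\<close>
      also have "\<dots> = dirichlet_form (S j) w f f" by (simp add: dirichlet_form_def)
      finally show ?thesis using B_nonneg [OF j] by (simp add: mult.assoc mult_left_mono)
    qed
    finally show ?thesis .
  qed
  have "(\<Sum>j\<in>J. e j)\<^sup>2 \<le> (\<Sum>j\<in>J. (e j)\<^sup>2) * real (card J)"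
    using Cauchy_Schwarz_ineq_sum [of e "\<lambda>_. 1" J] by simp
  also have "\<dots> \<le> (\<Sum>j\<in>J. B * dirichlet_form (S j) w f f) * real (card J)"
    using cluster by (intro mult_right_mono sum_mono) auto
  also have "\<dots> = real (card J) * B * (\<Sum>j\<in>J. dirichlet_form (S j) w f f)"
    by (simp flip: sum_distrib_left)
  also have "\<dots> \<le> real (card J) * B * (\<omega> * (\<Sum>v\<in>V. (f v)\<^sup>2))"
  proof (rule mult_left_mono)
    show "(\<Sum>j\<in>J. dirichlet_form (S j) w f f) \<le> \<omega> * (\<Sum>v\<in>V. (f v)\<^sup>2)"
      using sum_dirichlet_form_le [OF graph assms(2) disjoint cover, of f]
        dirichlet_form_bandlimited [OF graph f] by linarith
    \<comment> \<open>For empty \<open>J\<close> the sign of \<open>B\<close> is unknown, but the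
      product is 0.\<close>
    show "0 \<le> real (card J) * B" using B_nonneg by (cases "J = {}") auto
  qed
  also have "\<dots> = (real (card J) * B * \<omega>) * (\<Sum>v\<in>V. (f v)\<^sup>2)" by simp
  also have "\<dots> \<le> \<gamma>\<^sup>2 * (\<Sum>v\<in>V. (f v)\<^sup>2)"
    using small(1) by (intro mult_right_mono) (auto simp: sum_nonneg)
  also have "\<dots> \<le> \<gamma>\<^sup>2 * (\<Sum>v\<in>V. \<bar>f v\<bar>)\<^sup>2"
  proof -
    have "sqrt (\<Sum>v\<in>V. (f v)\<^sup>2) \<le> (\<Sum>v\<in>V. \<bar>f v\<bar>)"
      using L2_set_le_sum_abs [of f V] by (simp add: L2_set_def)
    then show ?thesis by (simp add: mult_left_mono sqrt_le_D)
  qed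
  finally have "(\<Sum>j\<in>J. e j)\<^sup>2 \<le> (\<gamma> * (\<Sum>v\<in>V. \<bar>f v\<bar>))\<^sup>2" by (simp add: power_mult_distrib)
  then have "(\<Sum>j\<in>J. e j) \<le> \<gamma> * (\<Sum>v\<in>V. \<bar>f v\<bar>)"
    by (rule power2_le_imp_le) (simp add: small(2) sum_nonneg)
  \<comment> \<open>Bounding \<open>f\<close> by its error plus its samples puts the total error on
    both sides; \<open>\<gamma> < 1\<close> then allows it to be absorbed.\<close>
  also have "(\<Sum>v\<in>V. \<bar>f v\<bar>) \<le> (\<Sum>j\<in>J. e j + real (card (S j)) * \<bar>z j\<bar>)"
    unfolding split
  proof (intro sum_mono)
    fix j
    have "(\<Sum>v\<in>S j. \<bar>f v\<bar>) \<le> (\<Sum>v\<in>S j. \<bar>f v - z j\<bar> + \<bar>z j\<bar>)"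
      by (intro sum_mono) linarith
    then show "(\<Sum>v\<in>S j. \<bar>f v\<bar>) \<le> e j + real (card (S j)) * \<bar>z j\<bar>"
      by (simp add: e_def sum.distrib)
  qed
  finally have "(\<Sum>j\<in>J. e j) \<le> \<gamma> * ((\<Sum>j\<in>J. e j) + (\<Sum>j\<in>J. real (card (S j)) * \<bar>z j\<bar>))"
    using small(2) by (simp add: sum.distrib mult_left_mono)
  then have total: "(\<Sum>j\<in>J. e j) \<le> \<gamma> / (1 - \<gamma>) * (\<Sum>j\<in>J. real (card (S j)) * \<bar>z j\<bar>)"
    using small(3) by (simp add: pos_le_divide_eq algebra_simps)
  have "(\<Sum>v\<in>V. f v) - (\<Sum>j\<in>J. real (card (S j)) * z j) = (\<Sum>j\<in>J. \<Sum>v\<in>S j. f v - z j)"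
    by (simp add: split sum_subtractf)
  also have "\<bar>\<dots>\<bar> \<le> (\<Sum>j\<in>J. e j)"
    unfolding e_def by (intro order_trans [OF sum_abs] sum_mono sum_abs)
  also note total
  finally show ?thesis by (simp add: z_def sum_distrib_left mult.assoc)
qed

text \<open>The coefficients are \<open>cnj (\<psi> v) / c\<close>. Positivity on point masses makes
  them real, and the normalization by \<open>c\<close> makes them sum to 1.\<close>

lemma zeta_fun_weights:
  assumes "finite V" and "S \<subseteq> V" and "0 < card S" and supp: "\<psi> \<in> l2_space S"
    and nonorth: "l2_inner V \<psi> (phi0 S) \<noteq> 0"
    and positive: "\<And>f. f \<in> l2_space V \<Longrightarrow> (\<forall>v\<in>V. f v \<in> \<real>\<^sub>\<ge>\<^sub>0) \<Longrightarrow> zeta_fun V S \<psi> f \<in> \<real>\<^sub>\<ge>\<^sub>0"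
  shows "\<exists>a. (\<forall>f. zeta_fun V S \<psi> f = (\<Sum>v\<in>S. of_real (a v) * f v)) \<and> (\<Sum>v\<in>S. a v) = 1
    \<and> real (card S) * (\<Sum>v\<in>S. (a v)\<^sup>2) = (l2_norm V \<psi>)\<^sup>2 / (cmod (l2_inner V \<psi> (phi0 S)))\<^sup>2"
proof -
  define c where "c = of_real (sqrt (real (card S))) * l2_inner V \<psi> (phi0 S)"
  define b where "b v = cnj (\<psi> v) / c" for v
  have n: "real (card S) > 0" using assms(3) by simp
  have \<psi>0: "\<psi> v = 0" if "v \<notin> S" for v using supp that by (simp add: l2_space_def)
  have inner: "l2_inner V \<psi> f = (\<Sum>v\<in>S. cnj (\<psi> v) * f v)" for f
    unfolding l2_inner_def using assms(1,2) \<psi>0 by (intro sum.mono_neutral_right) auto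
  have zeta: "zeta_fun V S \<psi> f = (\<Sum>v\<in>S. b v * f v)" for f
    unfolding zeta_fun_def c_def [symmetric] by (simp add: inner b_def sum_divide_distrib)
  have b: "b v = of_real (Re (b v))" if v: "v \<in> S" for v
  proof -
    let ?f = "\<lambda>u. if u = v then 1 else (0::complex)"
    have "zeta_fun V S \<psi> ?f \<in> \<real>\<^sub>\<ge>\<^sub>0"
      using v assms(2) by (intro positive) (auto simp: l2_space_def)
    moreover have "zeta_fun V S \<psi> ?f = b v"
      using v finite_subset [OF assms(2,1)] by (simp add: zeta if_distrib cong: if_cong)
    ultimately have "b v \<in> \<real>" using nonneg_Reals_subset_Reals by auto
    then show ?thesis by simp
  qed
  \<comment> \<open>The root of \<open>card S\<close> cancels the normalization of
    \<open>phi0\<close>, so \<open>c\<close> is the pairing of \<open>\<psi>\<close> with the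
    indicator of \<open>S\<close>.\<close>
  have c: "c = (\<Sum>v\<in>S. cnj (\<psi> v))"
    using n by (simp add: c_def inner phi0_def flip: sum_divide_distrib)
  have "c \<noteq> 0" using nonorth n by (simp add: c_def)
  then have "(\<Sum>v\<in>S. b v) = 1" by (simp add: b_def c flip: sum_divide_distrib)
  then have "Re (\<Sum>v\<in>S. b v) = 1" by simp
  then have sum1: "(\<Sum>v\<in>S. Re (b v)) = 1" by simp
  have "(Re (b v))\<^sup>2 = (cmod (\<psi> v))\<^sup>2 / (cmod c)\<^sup>2" if "v \<in> S" for v
  proof -
    have "\<bar>Re (b v)\<bar> = cmod (b v)" using b [OF that] by (metis norm_of_real)
    then have "(Re (b v))\<^sup>2 = (cmod (b v))\<^sup>2" by (metis power2_abs)
    then show ?thesis by (simp add: b_def norm_divide power_divide)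
  qed
  then have "(\<Sum>v\<in>S. (Re (b v))\<^sup>2) = (\<Sum>v\<in>S. (cmod (\<psi> v))\<^sup>2) / (cmod c)\<^sup>2"
    by (simp add: sum_divide_distrib)
  also have "(\<Sum>v\<in>S. (cmod (\<psi> v))\<^sup>2) = (\<Sum>v\<in>V. (cmod (\<psi> v))\<^sup>2)"
    using assms(1,2) \<psi>0 by (intro sum.mono_neutral_left) auto
  also have "\<dots> = (l2_norm V \<psi>)\<^sup>2" by (simp add: l2_norm_def L2_set_def sum_nonneg)
  \<comment> \<open>The factor \<open>card S\<close> cancels the one contained in the squared
    modulus of \<open>c\<close>.\<close>
  finally have norm: "real (card S) * (\<Sum>v\<in>S. (Re (b v))\<^sup>2)
      = (l2_norm V \<psi>)\<^sup>2 / (cmod (l2_inner V \<psi> (phi0 S)))\<^sup>2"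
    using n by (simp add: c_def norm_mult power_mult_distrib)
  have "zeta_fun V S \<psi> f = (\<Sum>v\<in>S. of_real (Re (b v)) * f v)" for f
    unfolding zeta using b by (intro sum.cong) auto
  with sum1 norm show ?thesis by (intro exI [of _ "\<lambda>v. Re (b v)"]) simp
qed

section \<open>Assembly of the quadrature weights\<close>

theorem theorem6p3:
  fixes V :: "'v set" and w :: "'v \<Rightarrow> 'v \<Rightarrow> real"
    and J :: "'j set" and S :: "'j \<Rightarrow> 'v set" and \<psi> :: "'j \<Rightarrow> 'v \<Rightarrow> complex"
    and \<gamma> :: real
  assumes graph: "weighted_graph V w"
    and disjoint: "disjoint_family_on S J"
    and cover: "(\<Union>j\<in>J. S j) = V"
    and large: "\<And>j. j \<in> J \<Longrightarrow> card (S j) > 1"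
    and connected: "\<And>j. j \<in> J \<Longrightarrow> graph_connected (S j) w"
    and supp: "\<And>j. j \<in> J \<Longrightarrow> \<psi> j \<in> l2_space (S j)"
    and nonorth: "\<And>j. j \<in> J \<Longrightarrow> l2_inner V (\<psi> j) (phi0 (S j)) \<noteq> 0"
    and positive: "\<And>j f. j \<in> J \<Longrightarrow> f \<in> l2_space V \<Longrightarrow> (\<forall>v\<in>V. f v \<in> \<real>\<^sub>\<ge>\<^sub>0) \<Longrightarrow>
                     zeta_fun V (S j) (\<psi> j) f \<in> \<real>\<^sub>\<ge>\<^sub>0"
    and gamma: "0 < \<gamma>" "\<gamma> < 1 / 2"
  shows "\<exists>\<nu> :: 'j \<Rightarrow> real.
           (\<forall>j\<in>J. (1 - 2 * \<gamma>) / (1 - \<gamma>) * real (card (S j)) \<le> \<nu> j \<and>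
                  \<nu> j \<le> (3 - 2 * \<gamma>) / (1 - \<gamma>) * real (card (S j))) \<and>
           (\<forall>\<omega>\<ge>0. sqrt \<omega> \<le> \<gamma> / C_Xi V w J S \<psi> \<longrightarrow>
              (\<forall>f\<in>E_space V w \<omega>.
                 (\<Sum>v\<in>V. f v) = (\<Sum>j\<in>J. of_real (\<nu> j) * zeta_fun V (S j) (\<psi> j) f)))"
proof -
  have fin: "finite V" using graph by (simp add: weighted_graph_def)
  have sub: "S j \<subseteq> V" if "j \<in> J" for j using cover that by auto
  \<comment> \<open>Disjoint nonempty sets are distinct, so \<open>J\<close> embeds into the finite
    power set of \<open>V\<close>.\<close>
  have "inj_on S J"
    using disjoint large by (fastforce simp: inj_on_def disjoint_family_on_def)
  moreover have "finite (S ` J)"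
    using sub fin by (intro finite_subset [of "S ` J" "Pow V"]) auto
  ultimately have finJ: "finite J" by (rule finite_imageD [rotated])
  have "\<exists>a. (\<forall>f. zeta_fun V (S j) (\<psi> j) f = (\<Sum>v\<in>S j. of_real (a v) * f v))
      \<and> (\<Sum>v\<in>S j. a v) = 1
      \<and> real (card (S j)) * (\<Sum>v\<in>S j. (a v)\<^sup>2)
        = (l2_norm V (\<psi> j))\<^sup>2 / (cmod (l2_inner V (\<psi> j) (phi0 (S j))))\<^sup>2"
    (is "\<exists>a. ?W j a") if j: "j \<in> J" for j
  proof -
    have "0 < card (S j)" using large [OF j] by simp
    from fin sub [OF j] this supp [OF j] nonorth [OF j] positive [OF j]
    show ?thesis by (rule zeta_fun_weights)
  qed
  then have "\<exists>a. \<forall>j\<in>J. ?W j (a j)" by (intro bchoice) simp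
  then obtain a where a: "\<forall>j\<in>J. ?W j (a j)" ..
  define z where "z j f = (\<Sum>v\<in>S j. a j v * f v)" for j and f :: "'v \<Rightarrow> real"
  define R where "R f = (\<Sum>v\<in>V. f v) - (\<Sum>j\<in>J. real (card (S j)) * z j f)" for f
  define B where "B = (MAX j\<in>J. real (card (S j)) * Theta V w (S j) (\<psi> j))"
  define C where "C = C_Xi V w J S \<psi>"
  \<comment> \<open>The largest admissible cutoff; fixing it here makes the weights independent of
    \<open>\<omega>\<close>. For empty \<open>J\<close>, \<open>C\<close> is 0 and division by zero
    gives \<open>\<omega>0 = 0\<close>.\<close>
  define \<omega>0 where "\<omega>0 = (\<gamma> / C)\<^sup>2"
  have pos: "0 < lambda1 (S j) w" if "j \<in> J" for j
    using lambda1_pos [OF weighted_graph_subset [OF graph sub] connected large] that by blast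
  have le_B: "real (card (S j)) * Theta V w (S j) (\<psi> j) \<le> B" if "j \<in> J" for j
    unfolding B_def using finJ that by (intro Max_ge) auto
  have weights: "real (card (S j)) * (real (card (S j)) * (\<Sum>v\<in>S j. (a j v)\<^sup>2)) \<le> B * lambda1 (S j) w"
    if j: "j \<in> J" for j
  proof -
    \<comment> \<open>This identity turns the weighted-mean constant into \<open>Theta\<close>,
      whose denominator already carries \<open>lambda1\<close>.\<close>
    have "real (card (S j)) * (\<Sum>v\<in>S j. (a j v)\<^sup>2) = Theta V w (S j) (\<psi> j) * lambda1 (S j) w"
      using a j pos [OF j] by (simp add: Theta_def)
    then show ?thesis
      using mult_right_mono [OF le_B [OF j], of "lambda1 (S j) w"] pos [OF j] by (simp add: mult.assoc)
  qed
  \<comment> \<open>For empty \<open>J\<close> the maximum is an unspecified value, multiplied by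
    0.\<close>
  have "0 \<le> real (card J) * B"
  proof (cases "J = {}")
    case False
    then obtain j where j: "j \<in> J" by auto
    have "0 \<le> real (card (S j)) * Theta V w (S j) (\<psi> j)"
      using pos [OF j] by (simp add: Theta_def)
    then show ?thesis using le_B [OF j] by simp
  qed simp
  then have C: "0 \<le> C" "C\<^sup>2 = real (card J) * B"
    by (simp_all add: C_def C_Xi_def flip: B_def)
  then have small: "real (card J) * B * \<omega>0 \<le> \<gamma>\<^sup>2"
    by (simp add: \<omega>0_def power_divide flip: C(2))
  have dominated: "\<bar>R f\<bar> \<le> (\<Sum>j\<in>J. \<gamma> / (1 - \<gamma>) * real (card (S j)) * \<bar>z j f\<bar>)"
    if "f \<in> real_bandlimited V w \<omega>0" for f
    unfolding R_def z_def
    by (rule sampling_error_dominated [OF graph finJ disjoint cover large connected _ weights small _ _ that])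
      (use a gamma in auto)
  have zlin: "z j (\<lambda>v. s * f v + t * g v) = s * z j f + t * z j g" for j s t f g
    by (simp add: z_def sum_distrib_left sum.distrib [symmetric] algebra_simps)
  have Rlin: "R (\<lambda>v. s * f v + t * g v) = s * R f + t * R g" for s t f g
    by (simp add: R_def zlin sum.distrib sum_distrib_left algebra_simps)
  have "\<exists>\<delta>. (\<forall>j\<in>J. \<bar>\<delta> j\<bar> \<le> \<gamma> / (1 - \<gamma>) * real (card (S j)))
      \<and> (\<forall>f\<in>real_bandlimited V w \<omega>0. R f = (\<Sum>j\<in>J. \<delta> j * z j f))"
    using finJ real_bandlimited_lincomb zlin Rlin _ dominated
    by (rule dominated_functional_representation)
      (use gamma in \<open>auto intro!: mult_nonneg_nonneg divide_nonneg_nonneg\<close>)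
  then obtain \<delta> where \<delta>: "\<And>j. j \<in> J \<Longrightarrow> \<bar>\<delta> j\<bar> \<le> \<gamma> / (1 - \<gamma>) * real (card (S j))"
    and R: "\<And>f. f \<in> real_bandlimited V w \<omega>0 \<Longrightarrow> R f = (\<Sum>j\<in>J. \<delta> j * z j f)"
    by blast
  define \<nu> where "\<nu> j = real (card (S j)) + \<delta> j" for j
  have quad: "(\<Sum>v\<in>V. f v) = (\<Sum>j\<in>J. \<nu> j * z j f)" if "f \<in> real_bandlimited V w \<omega>0" for f
    using R [OF that] by (simp add: R_def \<nu>_def distrib_right sum.distrib)
  have "(1 - 2 * \<gamma>) / (1 - \<gamma>) * real (card (S j)) \<le> \<nu> j \<and>
      \<nu> j \<le> (3 - 2 * \<gamma>) / (1 - \<gamma>) * real (card (S j))" if j: "j \<in> J" for j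
  proof -
    define n where "n = real (card (S j))"
    define t where "t = \<gamma> / (1 - \<gamma>) * n"
    \<comment> \<open>The bound on \<open>\<delta>\<close> gives
      \<open>n - t \<le> \<nu> j \<le> n + t\<close>: the lower end is the stated one, the upper end
      lies below \<open>3 * n + t\<close>.\<close>
    have "(1 - 2 * \<gamma>) / (1 - \<gamma>) * n = n - t" "(3 - 2 * \<gamma>) / (1 - \<gamma>) * n = 3 * n + t"
      using gamma by (simp_all add: t_def field_simps)
    moreover have "\<bar>\<delta> j\<bar> \<le> t" "0 \<le> n" using \<delta> [OF j] by (simp_all add: t_def n_def)
    ultimately show ?thesis unfolding \<nu>_def n_def [symmetric] by linarith
  qed
  moreover have "(\<Sum>v\<in>V. f v) = (\<Sum>j\<in>J. of_real (\<nu> j) * zeta_fun V (S j) (\<psi> j) f)"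
    if \<omega>: "0 \<le> \<omega>" "sqrt \<omega> \<le> \<gamma> / C_Xi V w J S \<psi>" and f: "f \<in> E_space V w \<omega>" for \<omega> f
  proof -
    have "\<omega> \<le> \<omega>0"
      using \<omega> by (simp add: \<omega>0_def C_def sqrt_le_D)
    \<comment> \<open>Since \<open>\<nu>\<close> and \<open>a\<close> are real, the complex identity
      splits into the real ones for the two parts of \<open>f\<close>.\<close>
    then have mem: "(\<lambda>v. Re (f v)) \<in> real_bandlimited V w \<omega>0" "(\<lambda>v. Im (f v)) \<in> real_bandlimited V w \<omega>0"
      using E_space_Re_Im [OF graph f] real_bandlimited_mono [OF graph] by blast+
    have "(\<Sum>j\<in>J. of_real (\<nu> j) * zeta_fun V (S j) (\<psi> j) f)
        = (\<Sum>j\<in>J. of_real (\<nu> j) * (\<Sum>v\<in>S j. of_real (a j v) * f v))"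
      using a by (intro sum.cong) auto
    then show ?thesis
      using quad [OF mem(1)] quad [OF mem(2)] by (simp add: complex_eq_iff z_def)
  qed
  ultimately show ?thesis by blast
qed

end
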